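(* Assume $\mathfrak{hm} = 2^{\aleph_0}$. Then there exists a set of reals $E \subseteq \mathbb{R}$ which is $2^{\aleph_0}$-crowded and $2^{\aleph_0}$-entangled (with respect to the usual order) and which has a nontrivial autohomeomorphism (a homeomorphism $E \to E$ other than the identity).
   Context: For distinct $x,y \in {}^\omega2$, $\Delta(x,y)$ is the least $n$ with $x(n) \ne y(n)$. A set $S \subseteq {}^\omega 2$ is monochromatic if the parity of $\Delta(x,y)$ is the same for all distinct $x,y \in S$. $\mathfrak{hm}$ is the least cardinality of a family of monochromatic sets covering ${}^\omega2$. A set $A \subseteq \mathbb{R}$ is $\kappa$-crowded if $|U \cap A| \ge \kappa$ for every open $U \subseteq \mathbb{R}$ with $U \cap A \ne \emptyset$. For two $m$-tuples $e,e'$ of reals, $t(e,e') \in {}^m 2$ is defined by $t(e,e')_i = 1$ iff $e'_i < e_i$; for $t\in{}^m2$, $\neg t = \langle 1-t_i\rangle$; $e,e'$ realize $t$ if $t(e,e')\in\{t,\neg t\}$. A tuple is 1-1 if its entries are pairwise distinct; two tuples are disjoint if they share no entry. For an infinite cardinal $\kappa$ and $m>0$, $E$ is $(\kappa,m)$-entangled if $|E|\ge\kappa$ and for every collection $F$ of size $\kappa$ of 1-1, mutually disjoint $m$-tuples of elements of $E$ and every $t\in{}^m2$, two distinct elements of $F$ realize $t$; $E$ is $\kappa$-entangled if it is $(\kappa,m)$-entangled for every $m>0$. *)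

theory Defs
  imports "HOL-Analysis.Analysis"
begin

unbundle cardinal_syntax

text \<open>Cardinals are represented as cardinal orders, compared by \<open>=o\<close> and \<open>\<le>o\<close>.
  The types of the cardinals involved may differ, so equality of cardinals is \<open>=o\<close>.\<close>

abbreviation continuum :: "(nat \<Rightarrow> bool) rel" where
  "continuum \<equiv> ctwo ^c natLeq"


subsection \<open>The cardinal hm\<close>

text \<open>Points of the Cantor space are functions of type \<^typ>\<open>nat \<Rightarrow> bool\<close>.
  \<open>Delta x y\<close> is meaningful only for distinct \<open>x\<close> and \<open>y\<close>.\<close>

definition Delta :: "(nat \<Rightarrow> bool) \<Rightarrow> (nat \<Rightarrow> bool) \<Rightarrow> nat" where
  "Delta x y = (LEAST n. x n \<noteq> y n)"

definition monochromatic :: "(nat \<Rightarrow> bool) set \<Rightarrow> bool" where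
  "monochromatic S \<longleftrightarrow> (\<exists>p. \<forall>x\<in>S. \<forall>y\<in>S. x \<noteq> y \<longrightarrow> even (Delta x y) = p)"

definition monochromatic_cover :: "(nat \<Rightarrow> bool) set set \<Rightarrow> bool" where
  "monochromatic_cover C \<longleftrightarrow> (\<forall>S\<in>C. monochromatic S) \<and> \<Union>C = UNIV"

definition hm :: "(nat \<Rightarrow> bool) set rel" where
  "hm = |SOME C. monochromatic_cover C \<and> (\<forall>D. monochromatic_cover D \<longrightarrow> |C| \<le>o |D| )|"

text \<open>The choice in the definition of \<open>hm\<close> is always from a nonempty collection, so
  \<open>hm\<close> is the least cardinality of a monochromatic cover.\<close>

lemma hm_least:
  shows "\<exists>C. monochromatic_cover C \<and> hm = |C|"
    and "monochromatic_cover D \<Longrightarrow> hm \<le>o |D|"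
proof -
  let ?R = "{ |C| | C. monochromatic_cover C}"
  let ?P = "\<lambda>C. monochromatic_cover C \<and> (\<forall>D. monochromatic_cover D \<longrightarrow> |C| \<le>o |D| )"
  have "monochromatic_cover (range (\<lambda>x. {x}))"
    by (auto simp: monochromatic_cover_def monochromatic_def)
  then have "?R \<noteq> {}" by blast
  moreover have "\<forall>r\<in>?R. Card_order r"
    using card_of_Card_order by blast
  ultimately have "\<exists>r\<in>?R. \<forall>r'\<in>?R. r \<le>o r'"
    by (rule exists_minim_Card_order)
  then have "\<exists>C. ?P C" by blast
  then have *: "?P (SOME C. ?P C)" by (rule someI_ex)
  show "\<exists>C. monochromatic_cover C \<and> hm = |C|"
    using * unfolding hm_def by blast
  show "monochromatic_cover D \<Longrightarrow> hm \<le>o |D|"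
    using * unfolding hm_def by blast
qed


subsection \<open>Crowded and entangled sets of reals\<close>

definition crowded :: "'k rel \<Rightarrow> real set \<Rightarrow> bool" where
  "crowded \<kappa> A \<longleftrightarrow> (\<forall>U. open U \<and> U \<inter> A \<noteq> {} \<longrightarrow> \<kappa> \<le>o |U \<inter> A| )"

text \<open>An \<open>m\<close>-tuple of reals is a list of length \<open>m\<close>, and an element of \<open>2\<^sup>m\<close> is a Boolean list
  of length \<open>m\<close>, with \<^const>\<open>True\<close> for 1.\<close>

definition tuple_type :: "real list \<Rightarrow> real list \<Rightarrow> bool list" where
  "tuple_type e e' = map2 (\<lambda>a a'. a' < a) e e'"

definition realize :: "real list \<Rightarrow> real list \<Rightarrow> bool list \<Rightarrow> bool" where
  "realize e e' t \<longleftrightarrow> tuple_type e e' \<in> {t, map Not t}"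

text \<open>The notion is intended for infinite \<open>\<kappa>\<close> and \<open>m > 0\<close>.\<close>

definition entangled_dim :: "'k rel \<Rightarrow> nat \<Rightarrow> real set \<Rightarrow> bool" where
  "entangled_dim \<kappa> m E \<longleftrightarrow>
     \<kappa> \<le>o |E| \<and>
     (\<forall>F :: real list set. \<forall>t :: bool list.
        |F| =o \<kappa> \<and>
        (\<forall>e\<in>F. length e = m \<and> set e \<subseteq> E \<and> distinct e) \<and>
        (\<forall>e\<in>F. \<forall>e'\<in>F. e \<noteq> e' \<longrightarrow> set e \<inter> set e' = {}) \<and>
        length t = m
        \<longrightarrow> (\<exists>e\<in>F. \<exists>e'\<in>F. e \<noteq> e' \<and> realize e e' t))"

definition entangled :: "'k rel \<Rightarrow> real set \<Rightarrow> bool" where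
  "entangled \<kappa> E \<longleftrightarrow> (\<forall>m>0. entangled_dim \<kappa> m E)"

end

theory Submission
  imports Defs
begin

text \<open>Flipping the odd bits of a point of the Cantor space preserves \<open>Delta\<close>. Lexicographically it
  preserves the order of a pair with even \<open>Delta\<close> and reverses the order of a pair with odd
  \<open>Delta\<close>, so it is monotone exactly on the monochromatic sets. The set \<open>E\<close> consists of the images
  in the Cantor set of points \<open>x i\<close> and of their flips, for \<open>i\<close> in a well-order of type continuum; the
  flip is the autohomeomorphism. The point \<open>x i\<close> is chosen outside all monochromatic sets of the form
  \<open>{z. (earlier points, z, flip z) \<in> C}\<close>, for fewer than continuum many closed sets \<open>C\<close>; this is
  possible because hm is the continuum.

  Given a family \<open>F\<close> of tuples and a type, let \<open>C\<close> be the closure of \<open>F\<close>. For almost all tuples in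
  \<open>F\<close>, the section of \<open>C\<close> over the coordinates below the top index contains \<open>x i\<close> and is hence not
  monochromatic, so it contains two points that realize the type on the top coordinates. By induction
  on the number of coordinates, two tuples with the same finite approximation to these two points
  realize the type on the remaining coordinates. Members of \<open>F\<close> close to the two resulting points of
  \<open>C\<close> realize the type on all coordinates.\<close>


subsection \<open>Flipping the odd bits\<close>

type_synonym cantor = "nat \<Rightarrow> bool"

definition flip :: "bool \<Rightarrow> cantor \<Rightarrow> cantor" where
  "flip b x = (\<lambda>n. x n \<noteq> (b \<and> odd n))"

definition lex_less :: "cantor \<Rightarrow> cantor \<Rightarrow> bool" where
  "lex_less x y \<longleftrightarrow> (\<exists>n. (\<forall>m<n. x m = y m) \<and> \<not> x n \<and> y n)"

definition restr :: "nat \<Rightarrow> cantor \<Rightarrow> bool list" where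
  "restr n x = map x [0..<n]"

lemma length_restr [simp]: "length (restr n x) = n"
  by (simp add: restr_def)

lemma restr_eq_iff: "restr n x = restr n y \<longleftrightarrow> (\<forall>m<n. x m = y m)"
  by (auto simp: restr_def)

lemma restr_eq_mono: "restr n x = restr n y \<Longrightarrow> m \<le> n \<Longrightarrow> restr m x = restr m y"
  by (auto simp: restr_eq_iff)

lemma Delta_neq: "x \<noteq> y \<Longrightarrow> x (Delta x y) \<noteq> y (Delta x y)"
  unfolding Delta_def by (rule LeastI_ex) auto

lemma Delta_least: "m < Delta x y \<Longrightarrow> x m = y m"
  unfolding Delta_def using not_less_Least by blast

lemma Delta_eqI: "(\<And>m. m < n \<Longrightarrow> x m = y m) \<Longrightarrow> x n \<noteq> y n \<Longrightarrow> Delta x y = n"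
  unfolding Delta_def by (rule Least_equality) (auto intro: leI)

lemma Delta_commute: "Delta x y = Delta y x"
  by (simp add: Delta_def eq_commute)

lemma restr_neq: "x \<noteq> y \<Longrightarrow> Delta x y < n \<Longrightarrow> restr n x \<noteq> restr n y"
  using Delta_neq by (auto simp: restr_eq_iff)

lemma Delta_less: "restr n x \<noteq> restr n y \<Longrightarrow> Delta x y < n"
  unfolding restr_eq_iff using Delta_least[of _ x y] by (meson less_le_trans not_less)

lemma lex_less_iff:
  assumes "x \<noteq> y"
  shows "lex_less x y \<longleftrightarrow> y (Delta x y)"
proof
  assume "lex_less x y"
  then obtain n where "\<forall>m<n. x m = y m" "\<not> x n" "y n" unfolding lex_less_def by blast
  then show "y (Delta x y)" using Delta_eqI[of n x y] by auto
next
  assume "y (Delta x y)"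
  with assms show "lex_less x y" unfolding lex_less_def
    using Delta_neq[of x y] Delta_least[of _ x y] by blast
qed

lemma lex_less_commute: "x \<noteq> y \<Longrightarrow> lex_less y x \<longleftrightarrow> \<not> lex_less x y"
  using Delta_neq[of x y] by (simp add: lex_less_iff lex_less_iff[of y x] Delta_commute[of y x])

lemma lex_less_cong:
  assumes "restr n x' = restr n x" "restr n y' = restr n y" "restr n x \<noteq> restr n y"
  shows "lex_less x' y' \<longleftrightarrow> lex_less x y"
proof -
  have less: "Delta x y < n" using assms(3) by (rule Delta_less)
  have eq: "x' m = x m" "y' m = y m" if "m < n" for m
    using assms(1,2) that by (auto simp: restr_eq_iff)
  have neq: "x (Delta x y) \<noteq> y (Delta x y)" using assms(3) by (intro Delta_neq) auto
  have "Delta x' y' = Delta x y"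
    using eq less neq Delta_least[of _ x y] by (intro Delta_eqI) auto
  then show ?thesis
    using eq less neq lex_less_iff[of x y] lex_less_iff[of x' y'] by fastforce
qed

lemma flip_False [simp]: "flip False x = x"
  by (simp add: flip_def)

lemma flip_True_neq: "flip True x \<noteq> x"
  by (auto simp: flip_def dest: fun_cong[of _ _ 1])

lemma flip_flip [simp]: "flip b (flip b x) = x"
  by (auto simp: flip_def)

lemma flip_flip_xor: "flip b (flip c x) = flip (b \<noteq> c) x"
  by (auto simp: flip_def fun_eq_iff)

lemma flip_eq_iff [simp]: "flip b x = flip b y \<longleftrightarrow> x = y"
  by (metis flip_flip)

lemma Delta_flip [simp]: "Delta (flip b x) (flip b y) = Delta x y"
  unfolding Delta_def flip_def by (rule arg_cong[where f = Least]) auto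

lemma restr_flip_cong: "restr n x = restr n y \<Longrightarrow> restr n (flip b x) = restr n (flip b y)"
  by (auto simp: restr_eq_iff flip_def)

lemma lex_less_flip:
  assumes "x \<noteq> y"
  shows "lex_less (flip b x) (flip b y) \<longleftrightarrow> lex_less x y \<noteq> (b \<and> odd (Delta x y))"
  using assms by (simp add: lex_less_iff) (simp add: flip_def)

text \<open>The identity and the flip order a pair alike when its \<open>Delta\<close> is even and
  oppositely when it is odd. A set that is not monochromatic has pairs of both parities, and
  exchanging the two points reverses both orders, so all four patterns occur.\<close>

lemma not_monochromatic_pattern:
  assumes "\<not> monochromatic S" "inj_on b B"
  obtains z z' where "z \<in> S" "z' \<in> S" "z \<noteq> z'"
    "\<And>k. k \<in> B \<Longrightarrow> lex_less (flip (b k) z) (flip (b k) z') = t k"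
proof -
  \<comment> \<open>Since \<open>b\<close> is injective on \<open>B\<close>, the pattern becomes a
    function of the flip alone. Its value at a flip outside the image of \<open>B\<close> is
    arbitrary.\<close>
  define t' where "t' c = t (inv_into B b c)" for c
  have t': "t' (b k) = t k" if "k \<in> B" for k
    using that assms(2) by (simp add: t'_def)
  obtain y y' where y: "y \<in> S" "y' \<in> S" "y \<noteq> y'" "even (Delta y y') \<longleftrightarrow> t' False = t' True"
    using assms(1) unfolding monochromatic_def by metis
  \<comment> \<open>The parity of the pair is already right. Exchanging the points, which leaves
    \<open>Delta\<close> unchanged, corrects the order under the identity.\<close>
  define z where "z = (if lex_less y y' = t' False then y else y')"
  define z' where "z' = (if lex_less y y' = t' False then y' else y)"
  have z: "z \<in> S" "z' \<in> S" "z \<noteq> z'" "lex_less z z' = t' False" "even (Delta z z') \<longleftrightarrow> t' False = t' True"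
    using y lex_less_commute[of y y'] by (auto simp: z_def z'_def Delta_commute)
  have "lex_less (flip c z) (flip c z') = t' c" for c
    using z lex_less_flip[of z z' c] by (cases c) auto
  then show ?thesis using that[OF z(1-3)] t' by simp
qed

section \<open>Points with a given initial segment outside few monochromatic sets\<close>

definition extends :: "bool list \<Rightarrow> cantor \<Rightarrow> bool" where
  "extends s z \<longleftrightarrow> restr (length s) z = s"

lemma extends_restr_iff [simp]: "extends (restr n z) y \<longleftrightarrow> restr n y = restr n z"
  by (simp add: extends_def)

lemma continuum_eq_card_cantor: "continuum =o |UNIV :: cantor set|"
  by (simp add: cexp_def ctwo_def Func_def Field_natLeq Field_card_of card_of_refl)

text \<open>Preimages under prepending \<open>s\<close> are again monochromatic, and there are too
  few of them to cover the Cantor space when \<open>hm\<close> is the continuum.\<close>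

lemma uncovered_point:
  assumes hm: "hm =o continuum" and less: "|G| <o |UNIV :: cantor set|"
    and mono: "\<And>S. S \<in> G \<Longrightarrow> monochromatic S"
  obtains z where "extends s z" "z \<notin> \<Union>G"
proof -
  define app where "app y = (\<lambda>n. if n < length s then s ! n else y (n - length s))" for y :: cantor
  define G' where "G' = (\<lambda>S. app -` S) ` G"
  have Delta_app: "Delta (app x) (app y) = length s + Delta x y" if "x \<noteq> y" for x y
    using Delta_neq[OF that] Delta_least[of _ x y] by (intro Delta_eqI) (auto simp: app_def)
  have app_neq: "app x \<noteq> app y" if "x \<noteq> y" for x y
  proof -
    from that obtain n where "x n \<noteq> y n" by (auto simp: fun_eq_iff)
    then have "app x (n + length s) \<noteq> app y (n + length s)" by (simp add: app_def)
    then show ?thesis by metis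
  qed
  have "\<forall>S\<in>G'. monochromatic S"
  proof
    fix S' assume "S' \<in> G'"
    then obtain S where S: "S \<in> G" "S' = app -` S" by (auto simp: G'_def)
    from mono[OF S(1)] obtain p where
      p: "\<forall>x\<in>S. \<forall>y\<in>S. x \<noteq> y \<longrightarrow> even (Delta x y) = p"
      unfolding monochromatic_def ..
    \<comment> \<open>Prepending \<open>s\<close> adds \<open>length s\<close> to every
      \<open>Delta\<close>, so it changes all parities or none.\<close>
    have "even (Delta x y) = (p = even (length s))" if "x \<in> S'" "y \<in> S'" "x \<noteq> y" for x y
      using p[rule_format, of "app x" "app y"] that app_neq[of x y] Delta_app[of x y] S(2) by auto
    then show "monochromatic S'" unfolding monochromatic_def by (intro exI ballI impI)
  qed
  moreover have "\<not> monochromatic_cover G'"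
  proof
    assume "monochromatic_cover G'"
    then have "hm \<le>o |G'|" by (rule hm_least(2))
    also have "|G'| \<le>o |G|" unfolding G'_def by (rule card_of_image)
    finally have "hm <o |UNIV :: cantor set|" using less by (rule ordLeq_ordLess_trans)
    moreover have "hm =o |UNIV :: cantor set|"
      using hm continuum_eq_card_cantor by (rule ordIso_transitive)
    ultimately show False using not_ordLess_ordIso by blast
  qed
  ultimately obtain y where "y \<notin> \<Union>G'" unfolding monochromatic_cover_def by blast
  moreover have "extends s (app y)"
    by (auto simp: extends_def restr_def app_def intro: nth_equalityI)
  ultimately show ?thesis using that[of "app y"] by (auto simp: G'_def)
qed

subsection \<open>Sets of size continuum\<close>

abbreviation big :: "'a set \<Rightarrow> bool" where
  "big J \<equiv> |UNIV :: cantor set| \<le>o |J|"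

lemma not_big_iff: "\<not> big J \<longleftrightarrow> |J| <o |UNIV :: cantor set|"
  by (rule not_ordLeq_iff_ordLess) (rule card_of_Well_order)+

lemma card_cantor_sequences: "|UNIV :: (nat \<Rightarrow> cantor) set| =o |UNIV :: cantor set|"
proof (rule card_of_ordIsoI)
  show "bij_betw (\<lambda>g n. g (fst (prod_decode n)) (snd (prod_decode n)))
    (UNIV :: (nat \<Rightarrow> cantor) set) UNIV"
    by (rule bij_betw_byWitness[where f' = "\<lambda>x n m. x (prod_encode (n, m))"]) auto
qed

lemma big_mono: "big J \<Longrightarrow> J \<subseteq> K \<Longrightarrow> big K"
  by (meson card_of_mono1 ordLeq_transitive)

lemma big_inj: "big J \<Longrightarrow> inj_on f J \<Longrightarrow> f ` J \<subseteq> K \<Longrightarrow> big K"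
  by (meson card_of_ordLeq ordLeq_transitive)

text \<open>Koenig's diagonal argument: the continuum has uncountable cofinality.\<close>

lemma big_pigeonhole:
  fixes col :: "'a \<Rightarrow> 'c::countable"
  assumes "big J"
  obtains c where "big {j \<in> J. col j = c}"
proof -
  \<comment> \<open>\<open>J\<close> contains a copy of all sequences of points, so the diagonal
    argument can use one coordinate per colour.\<close>
  obtain h :: "(nat \<Rightarrow> cantor) \<Rightarrow> 'a" where h: "inj h" "range h \<subseteq> J"
    using assms card_cantor_sequences by (meson card_of_ordLeq ordIso_ordLeq_trans)
  have "\<exists>c. big {j \<in> J. col j = c}"
  proof (rule ccontr)
    assume no: "\<nexists>c. big {j \<in> J. col j = c}"
    have "(\<lambda>j. inv h j n) ` {j \<in> J. col j = from_nat n} \<noteq> UNIV" for n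
      using no surj_imp_ordLeq[of UNIV "\<lambda>j. inv h j n" "{j \<in> J. col j = from_nat n}"] by auto
    then have "\<exists>y. \<forall>j\<in>J. col j = from_nat n \<longrightarrow> inv h j n \<noteq> y" for n
      by (smt (verit) UNIV_eq_I image_eqI mem_Collect_eq)
    \<comment> \<open>Coordinate \<open>n\<close> of \<open>y\<close> differs from coordinate
      \<open>n\<close> of every sequence whose colour has number \<open>n\<close>; hence
      \<open>h y\<close> can have no colour.\<close>
    then obtain y where y: "\<And>n j. j \<in> J \<Longrightarrow> col j = from_nat n \<Longrightarrow> inv h j n \<noteq> y n" by metis
    from y[of "h y" "to_nat (col (h y))"] show False using h by auto
  qed
  with that show ?thesis by blast
qed

lemma infinite_cantor: "infinite (UNIV :: cantor set)"
proof -
  have "inj (\<lambda>n :: nat. (\<lambda>m. m = n) :: cantor)"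
    by (auto simp: inj_def fun_eq_iff)
  then show ?thesis using finite_imageD infinite_UNIV_nat rev_finite_subset by blast
qed

lemma not_big_UNIV_countable: "\<not> big (UNIV :: 'c::countable set)"
proof
  assume "big (UNIV :: 'c set)"
  from big_pigeonhole[OF this, of id] obtain c :: 'c where "big {c}" by auto
  then have "finite (UNIV :: cantor set)" using card_of_ordLeq_finite by blast
  with infinite_cantor show False by simp
qed

lemma not_big_Un:
  assumes "\<not> big J" "\<not> big K"
  shows "\<not> big (J \<union> K)"
  using assms infinite_cantor card_of_Un_ordLess_infinite unfolding not_big_iff by blast

lemma not_big_Times:
  assumes "\<not> big J" "\<not> big K"
  shows "\<not> big (J \<times> K)"
proof -
  \<comment> \<open>The summand of natural numbers makes \<open>Z\<close> infinite, so that it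
    absorbs the product, and keeps it below the continuum.\<close>
  define Z where "Z = J <+> (K <+> (UNIV :: nat set))"
  have Z: "\<not> big Z" "infinite Z"
    using assms not_big_UNIV_countable[where 'c = nat] infinite_cantor
    unfolding Z_def not_big_iff by (auto intro!: card_of_Plus_ordLess_infinite)
  have "|J| \<le>o |Z|" "|K| \<le>o |Z|" unfolding Z_def
    by (meson card_of_Plus1 card_of_Plus2 ordLeq_transitive)+
  then have "|J \<times> K| \<le>o |Z|"
    using Z card_of_Times_ordLeq_infinite_Field[OF _ _ _ card_of_Card_order, of Z J K]
    by (simp add: Field_card_of)
  with Z(1) show ?thesis by (meson ordLeq_transitive)
qed

lemma not_big_lists:
  assumes "\<not> big Y"
  shows "\<not> big (lists Y)"
proof
  assume "big (lists Y)"
  \<comment> \<open>There are only countably many lengths, so uncountable cofinality reduces the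
    claim to lists of one length.\<close>
  then obtain n where n: "big {l \<in> lists Y. length l = n}" by (rule big_pigeonhole)
  have "\<not> big {l \<in> lists Y. length l = n}" for n
  proof (induction n)
    case 0
    have "{l \<in> lists Y. length l = 0} = {[]}" by auto
    then show ?case using card_of_ordLeq_finite infinite_cantor by fastforce
  next
    case (Suc n)
    have "inj_on (\<lambda>l. (hd l, tl l)) {l \<in> lists Y. length l = Suc n}"
      by (rule inj_onI, rule list.expand) auto
    moreover have "(\<lambda>l. (hd l, tl l)) ` {l \<in> lists Y. length l = Suc n}
        \<subseteq> Y \<times> {l \<in> lists Y. length l = n}"
    proof (rule image_subsetI)
      fix l assume "l \<in> {l \<in> lists Y. length l = Suc n}"
      then show "(hd l, tl l) \<in> Y \<times> {l \<in> lists Y. length l = n}" by (cases l) auto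
    qed
    ultimately show ?case using not_big_Times[OF assms Suc.IH] big_inj by blast
  qed
  with n show False by blast
qed

lemma not_big_image: "\<not> big J \<Longrightarrow> \<not> big (f ` J)"
  by (meson card_of_image ordLeq_transitive)

subsection \<open>Choosing the points\<close>

text \<open>A \<open>code\<close> is a set of finite approximations to tuples and represents a closed set of tuples.
  The second component of an index prescribes an initial segment of the point, which makes the
  resulting set crowded.\<close>

type_synonym code = "(nat \<times> bool list list) set"
type_synonym idx = "code \<times> bool list"

definition ev :: "('i \<Rightarrow> cantor) \<Rightarrow> 'i \<times> bool \<Rightarrow> cantor" where
  "ev x q = flip (snd q) (x (fst q))"

definition tuple_restr :: "('i \<Rightarrow> cantor) \<Rightarrow> nat \<Rightarrow> ('i \<times> bool) list \<Rightarrow> bool list list" where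
  "tuple_restr x n qs = map (\<lambda>q. restr n (ev x q)) qs"

text \<open>The old value of \<open>x\<close> at \<open>i\<close> is irrelevant in \<open>sect x i T qs\<close>: the section is over those
  coordinates of \<open>qs\<close> whose index is not \<open>i\<close>.\<close>

definition sect :: "('i \<Rightarrow> cantor) \<Rightarrow> 'i \<Rightarrow> code \<Rightarrow> ('i \<times> bool) list \<Rightarrow> cantor set" where
  "sect x i T qs = {z. \<forall>n. (n, tuple_restr (x(i := z)) n qs) \<in> T}"

text \<open>The codes come from earlier indices and the lists use only indices up to
  \<open>i\<close>. Thus fewer than continuum many sets are avoided at each stage, while a code
  \<open>T\<close> is considered at every stage after \<open>(T, [])\<close>.\<close>

definition avoiding :: "(idx \<Rightarrow> cantor) \<Rightarrow> idx \<Rightarrow> cantor \<Rightarrow> bool" where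
  "avoiding x i z \<longleftrightarrow> extends (snd i) z \<and>
    (\<forall>j \<in> underS |UNIV :: idx set| i. (\<forall>b. z \<noteq> flip b (x j)) \<and>
      (\<forall>qs \<in> lists (insert i (underS |UNIV :: idx set| i) \<times> UNIV).
        monochromatic (sect x i (fst j) qs) \<longrightarrow> z \<notin> sect x i (fst j) qs))"

section \<open>Counting the indices and the transfinite recursion\<close>

lemma card_code: "|UNIV :: code set| =o |UNIV :: cantor set|"
proof (rule card_of_ordIsoI)
  have *: "infinite (UNIV :: (nat \<times> bool list list) set)"
    by (simp add: finite_prod)
  show "bij_betw (\<lambda>T n. from_nat_into UNIV n \<in> T) (UNIV :: code set) (UNIV :: cantor set)"
    by (rule bij_betw_byWitness[where f' = "\<lambda>x. {u. x (to_nat_on UNIV u)}"])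
      (auto simp: * from_nat_into_to_nat_on to_nat_on_from_nat_into_infinite)
qed

lemma card_idx: "|UNIV :: idx set| =o |UNIV :: cantor set|"
proof -
  have inf: "infinite (UNIV :: code set)"
    using card_code infinite_cantor card_of_ordIso_finite by blast
  moreover have "|UNIV :: bool list set| \<le>o |UNIV :: code set|"
  proof -
    have "\<not> big (UNIV :: bool list set)" by (rule not_big_UNIV_countable)
    then have "|UNIV :: bool list set| \<le>o |UNIV :: cantor set|"
      unfolding not_big_iff by (rule ordLess_imp_ordLeq)
    then show ?thesis using card_code ordIso_symmetric ordLeq_ordIso_trans by blast
  qed
  ultimately have "|(UNIV :: code set) \<times> (UNIV :: bool list set)| =o |UNIV :: code set|"
    using card_of_Times_infinite[of "UNIV :: code set" "UNIV :: bool list set"] by simp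
  then show ?thesis using card_code ordIso_transitive by (metis UNIV_Times_UNIV)
qed

lemma not_big_underS: "\<not> big (underS |UNIV :: idx set| i)"
proof -
  have "|underS |UNIV :: idx set| i| <o |UNIV :: idx set|"
    by (rule card_of_underS[OF card_of_Card_order]) (simp add: Field_card_of)
  then show ?thesis unfolding not_big_iff using card_idx ordLess_ordIso_trans by blast
qed

lemma not_big_insert: "\<not> big J \<Longrightarrow> \<not> big (insert a J)"
  using not_big_Un[of "{a}" J] card_of_ordLeq_finite[of "UNIV :: cantor set" "{a}"] infinite_cantor
  by auto

lemma exists_avoiding:
  assumes hm: "hm =o continuum"
  shows "\<exists>z. avoiding x i z"
proof -
  let ?U = "underS |UNIV :: idx set| i"
  define Q where "Q = lists (insert i ?U \<times> (UNIV :: bool set))"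
  \<comment> \<open>Singletons are monochromatic, so staying away from the flips of earlier points
    is a further case of avoiding monochromatic sets.\<close>
  define S1 where "S1 = (\<lambda>(j, b). {flip b (x j)}) ` (?U \<times> UNIV)"
  define S2 where "S2 = (\<lambda>(j, qs). sect x i (fst j) qs) ` (?U \<times> Q)"
  define G where "G = {S \<in> S1 \<union> S2. monochromatic S}"
  have "\<not> big Q" unfolding Q_def
    by (intro not_big_lists not_big_Times not_big_insert not_big_underS not_big_UNIV_countable)
  then have "\<not> big (S1 \<union> S2)" unfolding S1_def S2_def
    by (intro not_big_Un not_big_image not_big_Times not_big_underS not_big_UNIV_countable)
  then have "\<not> big G" unfolding G_def by (rule contrapos_nn) (erule big_mono, blast)
  then have "|G| <o |UNIV :: cantor set|" by (simp add: not_big_iff)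
  then obtain z where z: "extends (snd i) z" "z \<notin> \<Union>G"
    by (rule uncovered_point[OF hm]) (auto simp: G_def)
  have "avoiding x i z" unfolding avoiding_def
  proof (intro conjI ballI allI impI)
    show "extends (snd i) z" by (rule z)
  next
    fix j b assume "j \<in> ?U"
    then have "{flip b (x j)} \<in> S1" unfolding S1_def by (intro image_eqI[of _ _ "(j, b)"]) auto
    then have "{flip b (x j)} \<in> G" by (simp add: G_def monochromatic_def)
    with z show "z \<noteq> flip b (x j)" by auto
  next
    fix j qs
    assume "j \<in> ?U" "qs \<in> lists (insert i ?U \<times> UNIV)" and mono: "monochromatic (sect x i (fst j) qs)"
    then have "sect x i (fst j) qs \<in> S2"
      unfolding S2_def Q_def by (intro image_eqI[of _ _ "(j, qs)"]) simp_all
    with mono z show "z \<notin> sect x i (fst j) qs" by (auto simp: G_def)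
  qed
  then show ?thesis by blast
qed

text \<open>Sections override the value at \<open>i\<close>, so only values at earlier indices
  matter. This is what the well-founded recursion requires.\<close>

lemma avoiding_cong:
  assumes "\<And>j. j \<in> underS |UNIV :: idx set| i \<Longrightarrow> x j = y j"
  shows "avoiding x i z = avoiding y i z"
proof -
  have "tuple_restr (x(i := w)) n qs = tuple_restr (y(i := w)) n qs"
    if "qs \<in> lists (insert i (underS |UNIV :: idx set| i) \<times> UNIV)" for w n qs
    using that assms by (auto simp: tuple_restr_def ev_def)
  then have "sect x i T qs = sect y i T qs"
    if "qs \<in> lists (insert i (underS |UNIV :: idx set| i) \<times> UNIV)" for T qs
    using that by (simp add: sect_def)
  then show ?thesis using assms by (simp add: avoiding_def)
qed

lemma underS_iff: "j \<in> underS r i \<longleftrightarrow> (j, i) \<in> r - Id"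
  by (auto simp: underS_def)

lemma avoiding_family:
  assumes "hm =o continuum"
  obtains x where "\<And>i. avoiding x i (x i)"
proof -
  have "\<exists>x. \<forall>i. avoiding x i (x i)"
  proof (rule dependent_wf_choice)
    show "wf ( |UNIV :: idx set| - Id)"
      using card_of_Well_order[of "UNIV :: idx set"] by (simp add: well_order_on_def)
  qed (auto intro!: avoiding_cong exists_avoiding[OF assms] simp: underS_iff)
  with that show ?thesis by blast
qed

subsection \<open>Entangledness in the Cantor space\<close>

definition before :: "idx \<Rightarrow> idx \<Rightarrow> bool" where
  "before i j \<longleftrightarrow> i \<in> underS |UNIV :: idx set| j"

lemma before_total:
  assumes "i \<noteq> j"
  shows "before i j \<or> before j i"
proof -
  have "total_on UNIV |UNIV :: idx set|"
    using card_of_well_order_on[of "UNIV :: idx set"]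
    unfolding well_order_on_def linear_order_on_def by blast
  then have "(i, j) \<in> |UNIV :: idx set| \<or> (j, i) \<in> |UNIV :: idx set|"
    using assms unfolding total_on_def by (meson UNIV_I)
  then show ?thesis using assms by (simp add: before_def underS_def)
qed

lemma before_trans:
  assumes "before i j" "before j k"
  shows "before i k"
proof -
  have r: "trans |UNIV :: idx set|" "antisym |UNIV :: idx set|"
    using card_of_well_order_on[of "UNIV :: idx set"]
    unfolding well_order_on_def linear_order_on_def partial_order_on_def preorder_on_def by blast+
  have "(i, k) \<in> |UNIV :: idx set|" using assms transD[OF r(1), of i j k] by (auto simp: before_def underS_def)
  moreover have "i \<noteq> k" using assms antisymD[OF r(2), of i j] by (auto simp: before_def underS_def)
  ultimately show ?thesis by (simp add: before_def underS_def)
qed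

lemma finite_has_top:
  assumes "finite K" "K \<noteq> {}"
    and total: "\<And>i j. i \<noteq> j \<Longrightarrow> R i j \<or> R j i"
    and trans: "\<And>i j k. R i j \<Longrightarrow> R j k \<Longrightarrow> R i k"
  shows "\<exists>m\<in>K. \<forall>k\<in>K. k = m \<or> R k m"
  using assms(1,2)
proof (induction K rule: finite_ne_induct)
  case (insert a K)
  then obtain m where m: "m \<in> K" "\<forall>k\<in>K. k = m \<or> R k m" by blast
  show ?case
  proof (cases "R m a")
    case True
    with m have "k = a \<or> R k a" if "k \<in> insert a K" for k
      using that trans[of k m a] by auto
    then show ?thesis by blast
  next
    case False
    then have "a = m \<or> R a m" using total[of a m] by auto
    with m have "\<forall>k\<in>insert a K. k = m \<or> R k m" by simp
    then show ?thesis using m(1) by blast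
  qed
qed simp

lemma big_two: "big J \<Longrightarrow> \<exists>j\<in>J. \<exists>j'\<in>J. j \<noteq> j'"
proof (rule ccontr)
  assume "big J" and *: "\<not> (\<exists>j\<in>J. \<exists>j'\<in>J. j \<noteq> j')"
  then obtain a where "J \<subseteq> {a}" by blast
  then have "finite J" by (rule finite_subset) simp
  with \<open>big J\<close> infinite_cantor show False using card_of_ordLeq_finite by blast
qed

text \<open>A comparison settled by the first \<open>n\<close> bits is an open condition and
  survives replacing both points by approximations.\<close>

definition decides :: "nat \<Rightarrow> cantor \<Rightarrow> cantor \<Rightarrow> bool \<Rightarrow> bool" where
  "decides n y y' b \<longleftrightarrow> restr n y \<noteq> restr n y' \<and> lex_less y y' = b"

lemma decides_cong:
  "decides n y y' b \<Longrightarrow> restr n z = restr n y \<Longrightarrow> restr n z' = restr n y' \<Longrightarrow> decides n z z' b"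
  unfolding decides_def using lex_less_cong by metis

lemma decides_mono: "decides n y y' b \<Longrightarrow> n \<le> m \<Longrightarrow> decides m y y' b"
  unfolding decides_def using restr_eq_mono by blast

lemma decides_exists:
  assumes "finite A" "\<And>k. k \<in> A \<Longrightarrow> f k \<noteq> g k \<and> lex_less (f k) (g k) = t k"
  shows "\<exists>n. \<forall>k\<in>A. decides n (f k) (g k) (t k)"
proof (intro exI ballI)
  fix k assume k: "k \<in> A"
  then have "Delta (f k) (g k) < Suc (Max ((\<lambda>k. Delta (f k) (g k)) ` A))"
    using assms(1) by (simp add: le_imp_less_Suc)
  then show "decides (Suc (Max ((\<lambda>k. Delta (f k) (g k)) ` A))) (f k) (g k) (t k)"
    unfolding decides_def using assms(2)[OF k] restr_neq by blast
qed

text \<open>\<open>J\<close> indexes the family of tuples and \<open>w j k\<close> names coordinate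
  \<open>k\<close> of tuple \<open>j\<close>. The coordinate set \<open>A\<close> is arbitrary
  because the induction deletes the coordinates at the top index, and \<open>J\<close> varies
  because it is thinned out before the induction hypothesis is applied.\<close>

lemma entangled_core:
  fixes w :: "'j \<Rightarrow> nat \<Rightarrow> idx \<times> bool"
  assumes avoid: "\<And>i. avoiding x i (x i)"
    and fin: "finite A" and big: "big J"
    and inj: "\<And>j. j \<in> J \<Longrightarrow> inj_on (w j) A"
    and disj: "\<And>j j' k k'. j \<in> J \<Longrightarrow> j' \<in> J \<Longrightarrow> j \<noteq> j' \<Longrightarrow> k \<in> A \<Longrightarrow> k' \<in> A \<Longrightarrow> ev x (w j k) \<noteq> ev x (w j' k')"
  shows "\<exists>j\<in>J. \<exists>j'\<in>J. j \<noteq> j' \<and> (\<forall>k\<in>A. lex_less (ev x (w j k)) (ev x (w j' k)) = t k)"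
  using fin big inj disj
proof (induction A arbitrary: J rule: finite_psubset_induct)
  case (psubset A J)
  show ?case
  proof (cases "A = {}")
    case True
    then show ?thesis using big_two[OF psubset.prems(1)] by blast
  next
    case False
    then obtain k0 where k0: "k0 \<in> A" by blast
    obtain ks where ks: "set ks = A" using finite_list[OF psubset.hyps] by blast
    \<comment> \<open>This code represents the closure of the family. It is considered at all
      indices after \<open>(T, [])\<close>, and \<open>low\<close> singles out the tuples that are
      not entirely above that index.\<close>
    define T where "T = {(n, tuple_restr x n (map (w j) ks)) | n j. j \<in> J}"
    define low where "low j \<longleftrightarrow> (\<exists>k\<in>A. \<not> before (T, []) (fst (w j k)))" for j
    \<comment> \<open>Here \<open>i\<close> is the top index, \<open>B\<close> the coordinates
      there, and \<open>z\<close>, \<open>z'\<close> are points of the section that realize the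
      pattern on \<open>B\<close> within \<open>n\<close> bits.\<close>
    define ok where "ok j i B z z' n \<longleftrightarrow> B \<noteq> {} \<and> B = {k \<in> A. fst (w j k) = i} \<and>
        z \<in> sect x i T (map (w j) ks) \<and> z' \<in> sect x i T (map (w j) ks) \<and>
        (\<forall>k\<in>B. decides n (ev (x(i := z)) (w j k)) (ev (x(i := z')) (w j k)) (t k))"
      for j i B z z' n
    have not_low: "\<not> big {j \<in> J. low j}"
    proof -
      let ?L = "insert (T, []) (underS |UNIV :: idx set| (T, []))"
      have "\<forall>j\<in>{j. low j}. \<exists>k. k \<in> A \<and> \<not> before (T, []) (fst (w j k))"
        unfolding low_def by (simp add: Bex_def)
      from bchoice[OF this] obtain c where
        "\<forall>j\<in>{j. low j}. c j \<in> A \<and> \<not> before (T, []) (fst (w j (c j)))" ..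
      then have c: "c j \<in> A" "\<not> before (T, []) (fst (w j (c j)))" if "low j" for j
        using that by simp_all
      \<comment> \<open>Tuples are disjoint, so different low tuples have different offending
        coordinates, all in a small initial segment.\<close>
      have "inj_on (\<lambda>j. w j (c j)) {j \<in> J. low j}"
        using c(1) psubset.prems(3) unfolding inj_on_def by (metis (mono_tags, lifting) mem_Collect_eq)
      moreover have "(\<lambda>j. w j (c j)) ` {j \<in> J. low j} \<subseteq> ?L \<times> UNIV"
      proof (rule image_subsetI)
        fix j assume "j \<in> {j \<in> J. low j}"
        then have "\<not> before (T, []) (fst (w j (c j)))" using c(2)[of j] by simp
        then have "fst (w j (c j)) \<in> ?L" using before_total[of "(T, [])" "fst (w j (c j))"]
          unfolding before_def[symmetric] insert_iff by metis
        then show "w j (c j) \<in> ?L \<times> UNIV" by (simp add: mem_Times_iff)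
      qed
      moreover have "\<not> big (?L \<times> (UNIV :: bool set))"
        by (intro not_big_Times not_big_insert not_big_underS not_big_UNIV_countable)
      ultimately show ?thesis using big_inj by blast
    qed
    have high: "\<exists>i B z z' n. ok j i B z z' n" if j: "j \<in> J" and "\<not> low j" for j
    proof -
      have "\<exists>m\<in>(fst \<circ> w j) ` A. \<forall>k\<in>(fst \<circ> w j) ` A. k = m \<or> before k m"
        by (rule finite_has_top) (use psubset.hyps False before_total before_trans in simp_all)
      then obtain k1 where k1: "k1 \<in> A"
        and top: "\<And>k. k \<in> A \<Longrightarrow> fst (w j k) = fst (w j k1) \<or> before (fst (w j k)) (fst (w j k1))"
        by auto
      define i where "i = fst (w j k1)"
      define B where "B = {k \<in> A. fst (w j k) = i}"
      let ?S = "sect x i T (map (w j) ks)"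
      have T: "before (T, []) i" using \<open>\<not> low j\<close> k1 unfolding low_def i_def by blast
      have "w j k \<in> insert i (underS |UNIV :: idx set| i) \<times> UNIV" if "k \<in> A" for k
        using top[OF that] unfolding i_def before_def mem_Times_iff by simp
      then have "map (w j) ks \<in> lists (insert i (underS |UNIV :: idx set| i) \<times> UNIV)"
        using ks unfolding in_lists_conv_set set_map by blast
      moreover have "\<forall>qs \<in> lists (insert i (underS |UNIV :: idx set| i) \<times> UNIV).
          monochromatic (sect x i T qs) \<longrightarrow> x i \<notin> sect x i T qs"
        using avoid[of i, unfolded avoiding_def, THEN conjunct2, THEN bspec, OF T[unfolded before_def]]
        by simp
      ultimately have "monochromatic ?S \<longrightarrow> x i \<notin> ?S" by (rule bspec[rotated])
      \<comment> \<open>Putting \<open>x i\<close> back at \<open>i\<close> restores tuple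
        \<open>j\<close>, whose approximations are in \<open>T\<close> by definition.\<close>
      moreover have "x i \<in> ?S" using j by (auto simp: sect_def T_def)
      ultimately have "\<not> monochromatic ?S" by blast
      \<comment> \<open>Coordinates in \<open>B\<close> share the index \<open>i\<close>, so only
        their flips can distinguish them.\<close>
      moreover have "inj_on (\<lambda>k. snd (w j k)) B"
        using psubset.prems(2)[OF j] unfolding B_def inj_on_def by (auto simp: prod_eq_iff)
      ultimately obtain z z' where z: "z \<in> ?S" "z' \<in> ?S" "z \<noteq> z'"
        "\<And>k. k \<in> B \<Longrightarrow> lex_less (flip (snd (w j k)) z) (flip (snd (w j k)) z') = t k"
        by (rule not_monochromatic_pattern[where t = t]) (rule that, simp_all)
      have "\<exists>n. \<forall>k\<in>B. decides n (ev (x(i := z)) (w j k)) (ev (x(i := z')) (w j k)) (t k)"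
        using z(3,4) psubset.hyps by (intro decides_exists) (auto simp: B_def ev_def)
      then obtain n where
        n: "\<forall>k\<in>B. decides n (ev (x(i := z)) (w j k)) (ev (x(i := z')) (w j k)) (t k)" ..
      have "B \<noteq> {}" using k1 by (auto simp: B_def i_def)
      moreover have "B = {k \<in> A. fst (w j k) = i}" by (rule B_def)
      ultimately have "ok j i B z z' n" unfolding ok_def using z(1,2) n by simp
      then show ?thesis by (intro exI)
    qed
    then obtain I B Z Z' N where ok:
      "\<And>j. j \<in> J \<Longrightarrow> \<not> low j \<Longrightarrow> ok j (I j) (B j) (Z j) (Z' j) (N j)"
      by metis
    have "big {j \<in> J. \<not> low j}"
    proof (rule ccontr)
      assume "\<not> big {j \<in> J. \<not> low j}"
      then have "\<not> big ({j \<in> J. low j} \<union> {j \<in> J. \<not> low j})" using not_low by (intro not_big_Un)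
      moreover have "{j \<in> J. low j} \<union> {j \<in> J. \<not> low j} = J" by blast
      ultimately show False using psubset.prems(1) by simp
    qed
    \<comment> \<open>Only countably many values are possible: \<open>B j\<close> is recorded as a
      list, and both modified tuples by their first \<open>N j\<close> bits.\<close>
    then obtain c where "big {j \<in> {j \<in> J. \<not> low j}.
      (filter (\<lambda>k. k \<in> B j) ks, N j, tuple_restr (x(I j := Z j)) (N j) (map (w j) ks),
        tuple_restr (x(I j := Z' j)) (N j) (map (w j) ks)) = c}"
      by (rule big_pigeonhole)
    moreover obtain bl n s s' where "c = (bl, n, s, s')" by (cases c)
    ultimately have "big {j \<in> J. \<not> low j \<and> filter (\<lambda>k. k \<in> B j) ks = bl \<and> N j = n \<and>
      tuple_restr (x(I j := Z j)) n (map (w j) ks) = s \<and> tuple_restr (x(I j := Z' j)) n (map (w j) ks) = s'}"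
      (is "big ?J'") by (elim big_mono) auto
    moreover define B0 where "B0 = set bl"
    have B0: "B j = B0" if "j \<in> ?J'" for j
      using that ok[of j] ks unfolding B0_def ok_def by force
    obtain j0 where j0: "j0 \<in> ?J'" using big_two[OF \<open>big ?J'\<close>] by blast
    have B0': "B0 \<subseteq> A" "B0 \<noteq> {}" using ok[of j0] j0 B0[OF j0] unfolding ok_def by auto
    then have "A - B0 \<subset> A" by blast
    \<comment> \<open>The induction hypothesis settles the coordinates outside \<open>B0\<close> for
      two tuples with the same data.\<close>
    from psubset.IH[OF this \<open>big ?J'\<close>] psubset.prems(2,3)
    obtain j1 j2 where j12: "j1 \<in> ?J'" "j2 \<in> ?J'" "j1 \<noteq> j2"
      and lex: "\<And>k. k \<in> A - B0 \<Longrightarrow> lex_less (ev x (w j1 k)) (ev x (w j2 k)) = t k"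
      by (smt (verit) DiffD1 inj_on_subset Diff_subset mem_Collect_eq)
    have "\<exists>m. \<forall>k\<in>A - B0. decides m (ev x (w j1 k)) (ev x (w j2 k)) (t k)"
      using psubset.hyps lex j12 psubset.prems(3) by (intro decides_exists) auto
    then obtain m where m: "\<And>k. k \<in> A - B0 \<Longrightarrow> decides m (ev x (w j1 k)) (ev x (w j2 k)) (t k)"
      by blast
    define M where "M = max m n"
    have ok1: "ok j1 (I j1) B0 (Z j1) (Z' j1) n"
      using ok[of j1] j12(1) B0[OF j12(1)] by simp
    have ok2: "ok j2 (I j2) B0 (Z j2) (Z' j2) n"
      using ok[of j2] j12(2) B0[OF j12(2)] by simp
    \<comment> \<open>Points of a section give points of the closure, so members of the family come
      arbitrarily close to them.\<close>
    have approx: "\<exists>j'\<in>J. \<forall>k\<in>A. restr M (ev x (w j' k)) = restr M (ev (x(i := z)) (w j k))"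
      if "z \<in> sect x i T (map (w j) ks)" for j i z
    proof -
      from that have "(M, tuple_restr (x(i := z)) M (map (w j) ks)) \<in> T" by (simp add: sect_def)
      then obtain j' where "j' \<in> J" "tuple_restr (x(i := z)) M (map (w j) ks) = tuple_restr x M (map (w j') ks)"
        by (auto simp: T_def)
      then show ?thesis using ks by (intro bexI[of _ j']) (auto simp: tuple_restr_def)
    qed
    \<comment> \<open>The top point becomes \<open>Z j1\<close> in the first tuple and
      \<open>Z' j2\<close> in the second; members of the family then approximate the
      results.\<close>
    obtain j1' where j1': "j1' \<in> J"
      "\<And>k. k \<in> A \<Longrightarrow> restr M (ev x (w j1' k)) = restr M (ev (x(I j1 := Z j1)) (w j1 k))"
      using approx[of "Z j1" "I j1" j1] ok1 unfolding ok_def by blast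
    obtain j2' where j2': "j2' \<in> J"
      "\<And>k. k \<in> A \<Longrightarrow> restr M (ev x (w j2' k)) = restr M (ev (x(I j2 := Z' j2)) (w j2 k))"
      using approx[of "Z' j2" "I j2" j2] ok2 unfolding ok_def by blast
    have dec: "decides M (ev x (w j1' k)) (ev x (w j2' k)) (t k)" if k: "k \<in> A" for k
    proof (cases "k \<in> B0")
      case True
      \<comment> \<open>On \<open>B0\<close>, \<open>Z' j2\<close> looks like \<open>Z' j1\<close>
        up to level \<open>n\<close>, so the comparison of \<open>Z j1\<close> with
        \<open>Z' j1\<close> carries over.\<close>
      have "tuple_restr (x(I j1 := Z' j1)) n (map (w j1) ks) = tuple_restr (x(I j2 := Z' j2)) n (map (w j2) ks)"
        using j12 by simp
      then have "restr n (ev (x(I j2 := Z' j2)) (w j2 k)) = restr n (ev (x(I j1 := Z' j1)) (w j1 k))"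
        using k ks by (auto simp: tuple_restr_def)
      moreover have "restr n (ev x (w j1' k)) = restr n (ev (x(I j1 := Z j1)) (w j1 k))"
        by (rule restr_eq_mono[OF j1'(2)[OF k]]) (simp add: M_def)
      moreover have "restr n (ev x (w j2' k)) = restr n (ev (x(I j2 := Z' j2)) (w j2 k))"
        by (rule restr_eq_mono[OF j2'(2)[OF k]]) (simp add: M_def)
      moreover have "decides n (ev (x(I j1 := Z j1)) (w j1 k)) (ev (x(I j1 := Z' j1)) (w j1 k)) (t k)"
        using ok1 True unfolding ok_def by blast
      ultimately have "decides n (ev x (w j1' k)) (ev x (w j2' k)) (t k)"
        by - (rule decides_cong[of n "ev (x(I j1 := Z j1)) (w j1 k)"], simp_all)
      then show ?thesis by (rule decides_mono) (simp add: M_def)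
    next
      case False
      \<comment> \<open>Outside \<open>B0\<close> the replacement at the top index changes nothing,
        and the comparison from the induction hypothesis remains.\<close>
      then have "fst (w j1 k) \<noteq> I j1" "fst (w j2 k) \<noteq> I j2"
        using ok1 ok2 k unfolding ok_def by blast+
      then have "ev (x(I j1 := Z j1)) (w j1 k) = ev x (w j1 k)"
        "ev (x(I j2 := Z' j2)) (w j2 k) = ev x (w j2 k)"
        by (simp_all add: ev_def)
      moreover have "decides M (ev x (w j1 k)) (ev x (w j2 k)) (t k)"
        using m[of k] k False by - (rule decides_mono[of m], simp_all add: M_def)
      ultimately show ?thesis
        using j1'(2)[OF k] j2'(2)[OF k]
        by - (rule decides_cong[of M "ev x (w j1 k)" "ev x (w j2 k)"], simp_all)
    qed
    have "j1' \<noteq> j2'" using dec[OF k0] unfolding decides_def by auto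
    with dec j1'(1) j2'(1) show ?thesis unfolding decides_def by blast
  qed
qed

subsection \<open>Transfer to the reals\<close>

text \<open>The middle-thirds embedding: the ternary digits 0 and 2 leave gaps, which make it
  injective and order preserving for \<open>lex_less\<close>.\<close>

definition cantor_real :: "cantor \<Rightarrow> real" where
  "cantor_real x = (\<Sum>n. (if x n then 2 else 0) / 3 ^ Suc n)"

lemma cantor_real_summable: "summable (\<lambda>n. (if x n then 2 else 0) / 3 ^ Suc n :: real)"
proof (rule summable_comparison_test')
  show "summable (\<lambda>n. (1 / 3) ^ n :: real)" by (rule summable_geometric) simp
  show "norm ((if x n then 2 else 0) / 3 ^ Suc n :: real) \<le> (1 / 3) ^ n" for n
    by (simp add: power_divide field_simps)
qed

lemma cantor_real_nonneg: "0 \<le> cantor_real x"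
  unfolding cantor_real_def by (rule suminf_nonneg[OF cantor_real_summable]) simp

lemma cantor_real_le_1: "cantor_real x \<le> 1"
proof -
  have s: "(\<lambda>n. (2 / 3) * (1 / 3) ^ n :: real) sums ((2 / 3) * (1 / (1 - 1 / 3)))"
    by (intro sums_mult geometric_sums) simp
  have "cantor_real x \<le> (\<Sum>n. (2 / 3) * (1 / 3) ^ n)"
    unfolding cantor_real_def
    by (rule suminf_le[OF _ cantor_real_summable sums_summable[OF s]]) (simp add: power_divide)
  also have "\<dots> = 1" using sums_unique[OF s] by simp
  finally show ?thesis .
qed

lemma cantor_real_unfold:
  "cantor_real x = ((if x 0 then 2 else 0) + cantor_real (\<lambda>n. x (Suc n))) / 3"
proof -
  have "cantor_real x = (if x 0 then 2 else 0) / 3 + (\<Sum>n. (if x (Suc n) then 2 else 0) / 3 ^ Suc (Suc n))"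
    unfolding cantor_real_def using suminf_split_head[OF cantor_real_summable[of x]] by simp
  also have "(\<Sum>n. (if x (Suc n) then 2 else 0) / 3 ^ Suc (Suc n) :: real)
      = (\<Sum>n. (if x (Suc n) then 2 else 0) / 3 ^ Suc n / 3)"
    by (simp add: field_simps)
  also have "\<dots> = cantor_real (\<lambda>n. x (Suc n)) / 3"
    unfolding cantor_real_def by (rule suminf_divide[OF cantor_real_summable])
  finally show ?thesis by (simp add: add_divide_distrib)
qed

lemma cantor_real_diff:
  assumes "\<And>m. m < n \<Longrightarrow> x m = y m"
  shows "cantor_real x - cantor_real y
    = (cantor_real (\<lambda>m. x (m + n)) - cantor_real (\<lambda>m. y (m + n))) / 3 ^ n"
  using assms
proof (induction n arbitrary: x y)
  case (Suc n)
  have "cantor_real x - cantor_real y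
      = (cantor_real (\<lambda>m. x (Suc m)) - cantor_real (\<lambda>m. y (Suc m))) / 3"
    using cantor_real_unfold[of x] cantor_real_unfold[of y] Suc.prems[of 0]
    by (simp add: diff_divide_distrib)
  also have "cantor_real (\<lambda>m. x (Suc m)) - cantor_real (\<lambda>m. y (Suc m))
      = (cantor_real (\<lambda>m. x (Suc (m + n))) - cantor_real (\<lambda>m. y (Suc (m + n)))) / 3 ^ n"
    using Suc.prems by (intro Suc.IH) auto
  finally show ?case by simp
qed simp

lemma cantor_real_upper:
  assumes "restr n x = restr n y"
  shows "\<bar>cantor_real x - cantor_real y\<bar> \<le> 1 / 3 ^ n"
proof -
  let ?x = "\<lambda>m. x (m + n)" and ?y = "\<lambda>m. y (m + n)"
  have "\<bar>cantor_real ?x - cantor_real ?y\<bar> \<le> 1"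
    using cantor_real_nonneg[of ?x] cantor_real_nonneg[of ?y]
      cantor_real_le_1[of ?x] cantor_real_le_1[of ?y] by linarith
  moreover have "cantor_real x - cantor_real y = (cantor_real ?x - cantor_real ?y) / 3 ^ n"
    using assms by (intro cantor_real_diff) (simp add: restr_eq_iff)
  ultimately show ?thesis by (simp add: divide_right_mono)
qed

lemma cantor_real_lower:
  assumes "lex_less x y"
  shows "1 / 3 ^ Suc (Delta x y) \<le> cantor_real y - cantor_real x"
proof -
  have neq: "x \<noteq> y" using assms unfolding lex_less_def by blast
  define n where "n = Delta x y"
  let ?x = "\<lambda>m. x (m + n)" and ?y = "\<lambda>m. y (m + n)"
  have "y n" using assms lex_less_iff[OF neq] by (simp add: n_def)
  moreover have "\<not> x n" using Delta_neq[OF neq] \<open>y n\<close> by (simp add: n_def)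
  \<comment> \<open>The leading digits contribute a difference of 2/3, and the tails take back at
    most 1/3.\<close>
  ultimately have "1 / 3 \<le> cantor_real ?y - cantor_real ?x"
    using cantor_real_unfold[of ?x] cantor_real_unfold[of ?y]
      cantor_real_nonneg[of "\<lambda>m. ?y (Suc m)"] cantor_real_le_1[of "\<lambda>m. ?x (Suc m)"]
    by simp
  then have "1 / 3 / 3 ^ n \<le> (cantor_real ?y - cantor_real ?x) / 3 ^ n"
    by (intro divide_right_mono) simp_all
  also have "\<dots> = cantor_real y - cantor_real x"
    using Delta_least[of _ x y] by (intro cantor_real_diff[symmetric]) (simp add: n_def)
  finally show ?thesis by (simp add: n_def)
qed

lemma cantor_real_less_iff:
  assumes "x \<noteq> y"
  shows "cantor_real x < cantor_real y \<longleftrightarrow> lex_less x y"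
proof (cases "lex_less x y")
  case True
  have "0 < 1 / (3 :: real) ^ Suc (Delta x y)" by simp
  with True cantor_real_lower[of x y] show ?thesis by linarith
next
  case False
  then have "lex_less y x" using assms lex_less_commute[of x y] by simp
  have "0 < 1 / (3 :: real) ^ Suc (Delta y x)" by simp
  with \<open>lex_less y x\<close> False cantor_real_lower[of y x] show ?thesis by linarith
qed

lemma cantor_real_eq_iff: "cantor_real x = cantor_real y \<longleftrightarrow> x = y"
  using cantor_real_less_iff[of x y] cantor_real_less_iff[of y x] lex_less_commute[of x y] by fastforce

text \<open>On the Cantor set the distance determines \<open>Delta\<close> up to a factor 3, and the flip preserves
  \<open>Delta\<close>.\<close>

lemma flip_lipschitz:
  "\<bar>cantor_real (flip b x) - cantor_real (flip b y)\<bar> \<le> 3 * \<bar>cantor_real x - cantor_real y\<bar>"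
proof (cases "x = y")
  case False
  define n where "n = Delta x y"
  have "restr n (flip b x) = restr n (flip b y)"
    using Delta_least[of _ x y] by (intro restr_flip_cong) (simp add: restr_eq_iff n_def)
  then have "\<bar>cantor_real (flip b x) - cantor_real (flip b y)\<bar> \<le> 3 * (1 / 3 ^ Suc n)"
    using cantor_real_upper by fastforce
  also have "1 / 3 ^ Suc n \<le> \<bar>cantor_real x - cantor_real y\<bar>"
    using cantor_real_lower[of x y] cantor_real_lower[of y x] lex_less_commute[OF False]
    by (auto simp: n_def Delta_commute[of y x])
  finally show ?thesis by simp
qed simp

section \<open>Assembling the set of reals\<close>

theorem theorem4p1:
  assumes "hm =o continuum"
  shows "\<exists>E :: real set. crowded continuum E \<and> entangled continuum E \<and>
           (\<exists>f g. homeomorphism E E f g \<and> (\<exists>x\<in>E. f x \<noteq> x))"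
proof -
  obtain x where avoid: "\<And>i. avoiding x i (x i)"
    using avoiding_family[OF assms] by blast
  define E where "E = range (\<lambda>q. cantor_real (ev x q))"
  have ext: "extends (snd i) (x i)" for i
    using avoid[of i] by (simp add: avoiding_def)
  have neq: "x i \<noteq> flip b (x j)" if "before j i" for i j b
    using avoid[of i] that unfolding avoiding_def before_def by blast
  have x_inj: "inj x"
  proof (rule injI)
    fix i j assume "x i = x j"
    then show "i = j" using neq[of i j False] neq[of j i False] before_total[of i j] by auto
  qed
  have cont_le: "continuum \<le>o |K| \<longleftrightarrow> big K" for K :: "real set"
    using continuum_eq_card_cantor by (meson ordIso_ordLeq_trans ordIso_symmetric)
  \<comment> \<open>Fixing the second component of the index leaves continuum many points, all
    starting with \<open>s\<close>. This yields both crowdedness and the size of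
    \<open>E\<close>.\<close>
  have fibre: "big {cantor_real (x (T, s)) | T. True}" for s
  proof -
    have "|UNIV :: cantor set| \<le>o |UNIV :: code set|"
      using card_code ordIso_symmetric ordIso_imp_ordLeq by blast
    moreover have "inj (\<lambda>T. cantor_real (x (T, s)))"
      using x_inj by (auto simp: inj_def cantor_real_eq_iff)
    ultimately show ?thesis by (rule big_inj) auto
  qed
  have fibre_subset: "{cantor_real (x (T, s)) | T. True} \<subseteq> E" for s
    by (force simp: E_def ev_def intro: range_eqI[of _ _ "((_, s), False)"])
  have "crowded continuum E" unfolding crowded_def cont_le
  proof (intro allI impI, elim conjE)
    fix U :: "real set" assume "open U" "U \<inter> E \<noteq> {}"
    then obtain y where y: "cantor_real y \<in> U" by (auto simp: E_def)
    with \<open>open U\<close> obtain e where e: "e > 0" "ball (cantor_real y) e \<subseteq> U"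
      using openE by blast
    obtain n where n: "1 / 3 ^ n < e"
      using real_arch_pow_inv[OF e(1), of "1 / 3"] by (auto simp: power_divide)
    let ?K = "{cantor_real (x (T, restr n y)) | T. True}"
    have "?K \<subseteq> ball (cantor_real y) e"
    proof
      fix a assume "a \<in> ?K"
      then obtain T where a: "a = cantor_real (x (T, restr n y))" by blast
      have "restr n y = restr n (x (T, restr n y))" using ext[of "(T, restr n y)"] by simp
      from cantor_real_upper[OF this] n show "a \<in> ball (cantor_real y) e"
        by (simp add: a dist_real_def)
    qed
    with e(2) fibre_subset[of "restr n y"] have "?K \<subseteq> U \<inter> E" by blast
    with fibre show "big (U \<inter> E)" by (rule big_mono)
  qed
  moreover have "entangled continuum E" unfolding entangled_def entangled_dim_def cont_le
  proof (intro allI impI conjI; (elim conjE)?)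
    show "big E" by (rule big_mono[OF fibre fibre_subset])
  next
    fix m :: nat and F :: "real list set" and t :: "bool list"
    assume F: "|F| =o continuum" "\<forall>e\<in>F. length e = m \<and> set e \<subseteq> E \<and> distinct e"
      "\<forall>e\<in>F. \<forall>e'\<in>F. e \<noteq> e' \<longrightarrow> set e \<inter> set e' = {}" and t: "length t = m"
    have "\<exists>q. e ! k = cantor_real (ev x q)" if "e \<in> F" "k < m" for e k
      using that F(2) nth_mem[of k e] by (fastforce simp: E_def)
    then obtain w where w: "\<And>e k. e \<in> F \<Longrightarrow> k < m \<Longrightarrow> e ! k = cantor_real (ev x (w e k))"
      by metis
    have bigF: "big F"
      using F(1) continuum_eq_card_cantor
      by (meson ordIso_imp_ordLeq ordIso_symmetric ordIso_transitive)
    \<comment> \<open>The pattern is negated because \<open>tuple_type\<close> records where the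
      second tuple is smaller.\<close>
    have "\<exists>e\<in>F. \<exists>e'\<in>F. e \<noteq> e' \<and>
        (\<forall>k\<in>{..<m}. lex_less (ev x (w e k)) (ev x (w e' k)) = (\<not> t ! k))"
    proof (rule entangled_core[OF avoid _ bigF])
      show "inj_on (w e) {..<m}" if e: "e \<in> F" for e
      proof (rule inj_onI)
        fix k k' assume k: "k \<in> {..<m}" "k' \<in> {..<m}" "w e k = w e k'"
        then have "e ! k = e ! k'" using w[OF e] by simp
        then show "k = k'" using e F(2) k by (simp add: nth_eq_iff_index_eq)
      qed
      show "ev x (w e k) \<noteq> ev x (w e' k')"
        if "e \<in> F" "e' \<in> F" "e \<noteq> e'" "k \<in> {..<m}" "k' \<in> {..<m}" for e e' k k'
      proof
        assume "ev x (w e k) = ev x (w e' k')"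
        then have "e ! k = e' ! k'" using w that by simp
        moreover have "e ! k \<in> set e" "e' ! k' \<in> set e'" using F(2) that by auto
        ultimately show False using F(3) that by auto
      qed
    qed simp
    then obtain e e' where e: "e \<in> F" "e' \<in> F" "e \<noteq> e'"
      and lex: "\<And>k. k < m \<Longrightarrow> lex_less (ev x (w e k)) (ev x (w e' k)) = (\<not> t ! k)"
      by auto
    have len: "length e = m" "length e' = m" using e F(2) by auto
    have "tuple_type e e' = t" unfolding tuple_type_def
    proof (rule nth_equalityI)
      show "length (map2 (\<lambda>a a'. a' < a) e e') = length t" using len t by simp
      fix k assume "k < length (map2 (\<lambda>a a'. a' < a) e e')"
      then have k: "k < m" using len by simp
      have "e ! k \<in> set e" "e' ! k \<in> set e'" using len k by auto
      then have "e ! k \<noteq> e' ! k" using F(3)[rule_format, OF e] by auto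
      then have "ev x (w e k) \<noteq> ev x (w e' k)" using w e k by auto
      then have "(e' ! k < e ! k) = t ! k"
        using w[OF e(1) k] w[OF e(2) k] lex[OF k] cantor_real_less_iff[of "ev x (w e' k)" "ev x (w e k)"]
          lex_less_commute[of "ev x (w e k)" "ev x (w e' k)"] by simp
      then show "map2 (\<lambda>a a'. a' < a) e e' ! k = t ! k" using len k by simp
    qed
    with e show "\<exists>e\<in>F. \<exists>e'\<in>F. e \<noteq> e' \<and> realize e e' t"
      unfolding realize_def by blast
  qed
  moreover have "\<exists>f g. homeomorphism E E f g \<and> (\<exists>a\<in>E. f a \<noteq> a)"
  proof -
    \<comment> \<open>The flip transported to the Cantor set. It maps \<open>E\<close> into itself
      since \<open>E\<close> contains both flips of each \<open>x i\<close>, and it is its own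
      inverse.\<close>
    define f where "f a = cantor_real (flip True (inv cantor_real a))" for a
    have "inj cantor_real" by (simp add: inj_def cantor_real_eq_iff)
    then have f: "f (cantor_real y) = cantor_real (flip True y)" for y
      by (simp add: f_def)
    have f_E: "f ` E \<subseteq> E"
    proof
      fix a assume "a \<in> f ` E"
      then obtain i b where "a = cantor_real (flip True (flip b (x i)))"
        by (auto simp: E_def f ev_def)
      then have "a = cantor_real (ev x (i, \<not> b))" by (simp add: flip_flip_xor ev_def)
      then show "a \<in> E" unfolding E_def by blast
    qed
    have f_f: "f (f a) = a" if "a \<in> E" for a
      using that by (auto simp: E_def f)
    have "3-lipschitz_on E f"
    proof (rule lipschitz_onI)
      fix a b assume "a \<in> E" "b \<in> E"
      then show "dist (f a) (f b) \<le> 3 * dist a b"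
        using flip_lipschitz by (auto simp: E_def f dist_real_def)
    qed simp
    then have "continuous_on E f" by (rule lipschitz_on_continuous_on)
    then have "homeomorphism E E f f"
      using f_E f_f by (intro homeomorphismI) auto
    moreover have "cantor_real (ev x (i, b)) \<in> E \<and> f (cantor_real (ev x (i, b))) \<noteq> cantor_real (ev x (i, b))" for i b
      by (simp add: E_def f cantor_real_eq_iff flip_True_neq)
    ultimately show ?thesis by blast
  qed
  ultimately show ?thesis by blast
qed

end
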